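(* Let $(\mathbf{X},d)$ be a complete length space, let $\Omega\subsetneq\mathbf{X}$ be a bounded domain, and let $f$ be a positive Borel measurable function on $\overline\Omega$ with $\inf_\Omega f>0$, such that $\Gamma_f(x,y)\ne\emptyset$ for all $x,y\in\overline\Omega$. Let $u\in USC_L(\overline{\Omega})$ and $v\in LSC_L(\overline{\Omega})$ be respectively a bounded Monge subsolution and a bounded Monge supersolution of $|\nabla u|=f$ in $\Omega$. If $$\lim_{\delta\to0}\sup\{u(x)-v(x):\ x\in\overline{\Omega},\ d(x,\partial\Omega)\le\delta\}\le0,$$ then $u\le v$ in $\overline{\Omega}$.
   Context: For $x,y\in\overline{\Omega}$, $\Gamma_f(x,y)$ is the set of rectifiable curves $\gamma:[0,\ell]\to\overline{\Omega}$, parametrized by arc length, with $\gamma(0)=x$, $\gamma(\ell)=y$ and $\int_\gamma f\,ds<\infty$ (the constant curve is allowed when $x=y$), and $L_f(x,y):=\inf\{\int_\gamma f\,ds:\gamma\in\Gamma_f(x,y)\}$. $u\in USC_L(\overline{\Omega})$ (resp. $LSC_L(\overline\Omega)$) means that $u:\overline\Omega\to\mathbb{R}$ is upper (resp. lower) semicontinuous with respect to $L_f$: for every $x\in\overline{\Omega}$, $\limsup_{y\in\overline\Omega,\ L_f(x,y)\to0}u(y)\le u(x)$ (resp. $\liminf_{y\in\overline\Omega,\ L_f(x,y)\to0}u(y)\ge u(x)$). A function $u$ on $\Omega$, locally bounded with respect to the topology induced by $L_f$, is a Monge subsolution (resp. supersolution) of $|\nabla u|=f$ in $\Omega$ if for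 every $x_0\in\Omega$, $\limsup_{L_f(x,x_0)\to0}\frac{u(x_0)-u(x)}{L_f(x_0,x)}\le1$ (resp. $\ge1$). Also $d(x,\partial\Omega)=\inf_{y\in\partial\Omega}d(x,y)$. *)

theory Defs
  imports "HOL-Analysis.Analysis"
begin

definition curve_length :: "(real \<Rightarrow> 'a::metric_space) \<Rightarrow> real \<Rightarrow> real \<Rightarrow> ennreal" where
  "curve_length g a b =
     (SUP (n, t) \<in> {(n::nat, t::nat \<Rightarrow> real). t 0 = a \<and> t n = b \<and> mono_on {..n} t}.
        \<Sum>i<n. ennreal (dist (g (t i)) (g (t (Suc i)))))"

text \<open>The infimum over an empty set of curves is infinite, so in a length space any two
  points are joined by a rectifiable curve.\<close>

definition length_space :: "'a::metric_space set \<Rightarrow> bool" where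
  "length_space S \<longleftrightarrow>
     (\<forall>x\<in>S. \<forall>y\<in>S. ennreal (dist x y) =
        (INF g \<in> {g. path g \<and> path_image g \<subseteq> S \<and> pathstart g = x \<and> pathfinish g = y}.
           curve_length g 0 1))"

definition domain :: "'a::topological_space set \<Rightarrow> bool" where
  "domain S \<longleftrightarrow> open S \<and> connected S \<and> S \<noteq> {}"

definition arc_length_param :: "(real \<Rightarrow> 'a::metric_space) \<Rightarrow> real \<Rightarrow> bool" where
  "arc_length_param g l \<longleftrightarrow>
     0 \<le> l \<and> continuous_on {0..l} g \<and> (\<forall>t\<in>{0..l}. curve_length g 0 t = ennreal t)"

text \<open>The line integral of \<open>f\<close> along a curve on \<open>[0, l]\<close> that is parametrized by arc length.\<close>

definition line_integral :: "('a::metric_space \<Rightarrow> real) \<Rightarrow> real \<Rightarrow> (real \<Rightarrow> 'a) \<Rightarrow> ennreal" where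
  "line_integral f l g = (\<integral>\<^sup>+ t \<in> {0..l}. ennreal (f (g t)) \<partial>lborel)"

text \<open>A curve is a pair \<open>(l, g)\<close>; only the values of \<open>g\<close> on \<open>[0, l]\<close> matter.
  It is rectifiable because its length is the real number \<open>l\<close>.\<close>

definition Gamma_f ::
  "('a::metric_space \<Rightarrow> real) \<Rightarrow> 'a set \<Rightarrow> 'a \<Rightarrow> 'a \<Rightarrow> (real \<times> (real \<Rightarrow> 'a)) set" where
  "Gamma_f f \<Omega> x y =
     {(l, g). arc_length_param g l \<and> g ` {0..l} \<subseteq> closure \<Omega> \<and> g 0 = x \<and> g l = y \<and>
              line_integral f l g < \<infinity>}"

definition L_f :: "('a::metric_space \<Rightarrow> real) \<Rightarrow> 'a set \<Rightarrow> 'a \<Rightarrow> 'a \<Rightarrow> ennreal" where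
  "L_f f \<Omega> x y = (INF (l, g) \<in> Gamma_f f \<Omega> x y. line_integral f l g)"

text \<open>The filter of points \<open>y \<in> A\<close> with \<open>h y \<rightarrow> 0\<close>.\<close>

definition vanishing :: "'a set \<Rightarrow> ('a \<Rightarrow> ennreal) \<Rightarrow> 'a filter" where
  "vanishing A h = inf (filtercomap h (nhds 0)) (principal A)"

definition USC_L :: "('a::metric_space \<Rightarrow> real) \<Rightarrow> 'a set \<Rightarrow> ('a \<Rightarrow> real) set" where
  "USC_L f \<Omega> =
     {u. \<forall>x\<in>closure \<Omega>.
        Limsup (vanishing (closure \<Omega>) (\<lambda>y. L_f f \<Omega> x y)) (\<lambda>y. ereal (u y)) \<le> ereal (u x)}"

definition LSC_L :: "('a::metric_space \<Rightarrow> real) \<Rightarrow> 'a set \<Rightarrow> ('a \<Rightarrow> real) set" where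
  "LSC_L f \<Omega> =
     {u. \<forall>x\<in>closure \<Omega>.
        Liminf (vanishing (closure \<Omega>) (\<lambda>y. L_f f \<Omega> x y)) (\<lambda>y. ereal (u y)) \<ge> ereal (u x)}"

definition locally_bounded_L ::
  "('a::metric_space \<Rightarrow> real) \<Rightarrow> 'a set \<Rightarrow> ('a \<Rightarrow> real) \<Rightarrow> bool" where
  "locally_bounded_L f \<Omega> u \<longleftrightarrow>
     (\<forall>x\<^sub>0\<in>\<Omega>. \<exists>r>0. bounded (u ` {x\<in>\<Omega>. L_f f \<Omega> x\<^sub>0 x < r}))"

text \<open>The upper limit over \<open>L_f(x, x\<^sub>0) \<rightarrow> 0\<close> is taken over \<open>x \<noteq> x\<^sub>0\<close>,
  where the quotient makes sense.\<close>

definition monge_slope ::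
  "('a::metric_space \<Rightarrow> real) \<Rightarrow> 'a set \<Rightarrow> ('a \<Rightarrow> real) \<Rightarrow> 'a \<Rightarrow> ereal" where
  "monge_slope f \<Omega> u x\<^sub>0 =
     Limsup (vanishing (\<Omega> - {x\<^sub>0}) (\<lambda>x. L_f f \<Omega> x x\<^sub>0))
       (\<lambda>x. ereal (u x\<^sub>0 - u x) / enn2ereal (L_f f \<Omega> x\<^sub>0 x))"

definition monge_subsolution ::
  "('a::metric_space \<Rightarrow> real) \<Rightarrow> 'a set \<Rightarrow> ('a \<Rightarrow> real) \<Rightarrow> bool" where
  "monge_subsolution f \<Omega> u \<longleftrightarrow>
     locally_bounded_L f \<Omega> u \<and> (\<forall>x\<^sub>0\<in>\<Omega>. monge_slope f \<Omega> u x\<^sub>0 \<le> 1)"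

definition monge_supersolution ::
  "('a::metric_space \<Rightarrow> real) \<Rightarrow> 'a set \<Rightarrow> ('a \<Rightarrow> real) \<Rightarrow> bool" where
  "monge_supersolution f \<Omega> u \<longleftrightarrow>
     locally_bounded_L f \<Omega> u \<and> (\<forall>x\<^sub>0\<in>\<Omega>. monge_slope f \<Omega> u x\<^sub>0 \<ge> 1)"

end

theory Submission
  imports Defs
begin

text \<open>
  Suppose \<open>u x\<^sub>0 > v x\<^sub>0\<close> somewhere. Multiplying the subsolution by a constant \<open>\<theta> < 1\<close> close to
  \<open>1\<close> makes it strict: its slopes are at most \<open>\<theta>\<close>, while those of \<open>v\<close> are at least \<open>1\<close>. The
  function \<open>w = \<theta> u - v\<close> is bounded above and upper semicontinuous with respect to \<open>L\<^sub>f\<close>, and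
  its values near the boundary are well below \<open>w x\<^sub>0\<close>. If \<open>w\<close> attained its maximum at some \<open>x\<close>,
  then \<open>x\<close> would be an interior point with \<open>v x - v y \<le> \<theta> (u x - u y)\<close> for all \<open>y\<close>, so the slope
  of \<open>v\<close> at \<open>x\<close> would be at most \<open>\<theta>\<close>, a contradiction.

  Without compactness a maximum need not exist. Ekeland's variational principle
  (\<open>ekeland_variational_principle\<close>) supplies the substitute: a point \<open>x\<close> with \<open>w x\<^sub>0 \<le> w x\<close> and
  \<open>w y \<le> w x + \<epsilon> L\<^sub>f(x, y)\<close> for all \<open>y\<close>. The error adds only \<open>\<epsilon>\<close> to the slope, so
  \<open>\<theta> + \<epsilon> < 1\<close> still gives a contradiction (\<open>monge_slope_less_one\<close>).

  Ekeland's principle needs a complete metric, and most of the work goes into showing that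
  \<open>L\<^sub>f\<close> is one in the relevant region. It is symmetric, because curves can be reversed, and it
  satisfies the triangle inequality, because curves can be concatenated. Completeness
  (\<open>L_f_complete\<close>) comes from concatenating infinitely many curves of summable cost
  (\<open>L_f_le_suminf\<close>). Here the bound \<open>inf\<^sub>\<Omega> f > 0\<close> enters: a cheap curve that starts far from the
  boundary cannot leave \<open>\<Omega>\<close>, so its length is controlled by its cost. This can fail
  near the boundary, since \<open>f\<close> may be arbitrarily small on boundary points; but a sequence
  along which \<open>w\<close> increases from \<open>w x\<^sub>0\<close> stays away from there.
\<close>

section \<open>Length of curves\<close>

lemma curve_length_upper:
  assumes "t 0 = a" "t n = b" "mono_on {..n} t"
  shows "(\<Sum>i<n. ennreal (dist (g (t i)) (g (t (Suc i))))) \<le> curve_length g a b"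
  unfolding curve_length_def using assms by (intro SUP_upper2[of "(n, t)"]) auto

lemma curve_length_least:
  assumes "\<And>n t. \<lbrakk>t 0 = a; t n = b; mono_on {..n} t\<rbrakk> \<Longrightarrow>
             (\<Sum>i<n. ennreal (dist (g (t i)) (g (t (Suc i))))) \<le> C"
  shows "curve_length g a b \<le> C"
  unfolding curve_length_def using assms by (intro SUP_least) auto

lemma partition_in_interval:
  fixes t :: "nat \<Rightarrow> real"
  assumes "t 0 = a" "t n = b" "mono_on {..n} t" "i \<le> n"
  shows "t i \<in> {a..b}"
  using mono_onD[OF assms(3), of 0 i] mono_onD[OF assms(3), of i n] assms by auto

lemma partition_step:
  fixes t :: "nat \<Rightarrow> real"
  assumes t: "t 0 = a" "t n = b" "mono_on {..n} t" and "i < n"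
  shows "a \<le> t i" "t i \<le> t (Suc i)" "t (Suc i) \<le> b"
  using partition_in_interval[OF t, of i] partition_in_interval[OF t, of "Suc i"]
    mono_onD[OF t(3), of i "Suc i"] \<open>i < n\<close> by auto

lemma curve_length_mono_fun:
  assumes "\<And>s t. \<lbrakk>a \<le> s; s \<le> t; t \<le> b\<rbrakk> \<Longrightarrow> dist (g s) (g t) \<le> dist (h s) (h t)"
  shows "curve_length g a b \<le> curve_length h a b"
proof (rule curve_length_least)
  fix n and t :: "nat \<Rightarrow> real"
  assume t: "t 0 = a" "t n = b" "mono_on {..n} t"
  have "(\<Sum>i<n. ennreal (dist (g (t i)) (g (t (Suc i)))))
      \<le> (\<Sum>i<n. ennreal (dist (h (t i)) (h (t (Suc i)))))"
  proof (intro sum_mono ennreal_leI assms)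
    fix i assume "i \<in> {..<n}"
    then show "a \<le> t i" "t i \<le> t (Suc i)" "t (Suc i) \<le> b"
      using partition_step[OF t] by auto
  qed
  also have "\<dots> \<le> curve_length h a b" by (rule curve_length_upper[OF t])
  finally show "(\<Sum>i<n. ennreal (dist (g (t i)) (g (t (Suc i))))) \<le> curve_length h a b" .
qed

lemma curve_length_cong:
  "(\<And>t. a \<le> t \<Longrightarrow> t \<le> b \<Longrightarrow> g t = h t) \<Longrightarrow> curve_length g a b = curve_length h a b"
  by (intro antisym curve_length_mono_fun) auto

lemma curve_length_le_of_lipschitz:
  assumes "a \<le> b" "\<And>s t. \<lbrakk>a \<le> s; s \<le> t; t \<le> b\<rbrakk> \<Longrightarrow> dist (g s) (g t) \<le> t - s"
  shows "curve_length g a b \<le> ennreal (b - a)"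
proof (rule curve_length_least)
  fix n and t :: "nat \<Rightarrow> real"
  assume t: "t 0 = a" "t n = b" "mono_on {..n} t"
  have "(\<Sum>i<n. ennreal (dist (g (t i)) (g (t (Suc i))))) = ennreal (\<Sum>i<n. dist (g (t i)) (g (t (Suc i))))"
    by simp
  also have "\<dots> \<le> ennreal (\<Sum>i<n. t (Suc i) - t i)"
  proof (intro ennreal_leI sum_mono assms)
    fix i assume "i \<in> {..<n}"
    then show "a \<le> t i" "t i \<le> t (Suc i)" "t (Suc i) \<le> b"
      using partition_step[OF t] by auto
  qed
  also have "(\<Sum>i<n. t (Suc i) - t i) = b - a"
    using t by (simp add: sum_lessThan_telescope)
  finally show "(\<Sum>i<n. ennreal (dist (g (t i)) (g (t (Suc i))))) \<le> ennreal (b - a)" .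
qed

lemma dist_le_curve_length:
  assumes "a \<le> b" shows "ennreal (dist (g a) (g b)) \<le> curve_length g a b"
  using curve_length_upper[of "\<lambda>i. if i = 0 then a else b" a "Suc 0" b g] assms
  by (auto simp: mono_on_def)

lemma curve_length_shift:
  "curve_length (\<lambda>t. g (t + c)) a b = curve_length g (a + c) (b + c)"
proof -
  have le: "curve_length (\<lambda>t. g (t + c)) a b \<le> curve_length g (a + c) (b + c)"
    for g :: "real \<Rightarrow> 'a" and a b c
  proof (rule curve_length_least)
    fix n and t :: "nat \<Rightarrow> real"
    assume "t 0 = a" "t n = b" "mono_on {..n} t"
    then show "(\<Sum>i<n. ennreal (dist (g (t i + c)) (g (t (Suc i) + c)))) \<le> curve_length g (a + c) (b + c)"
      by (intro curve_length_upper[of "\<lambda>i. t i + c"]) (auto simp: mono_on_def)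
  qed
  show ?thesis
    using le[of g c a b] le[of "\<lambda>t. g (t + c)" "-c" "a + c" "b + c"] by (simp add: antisym)
qed

lemma curve_length_reverse:
  "curve_length (\<lambda>t. g (c - t)) a b = curve_length g (c - b) (c - a)"
proof -
  have le: "curve_length (\<lambda>t. g (c - t)) a b \<le> curve_length g (c - b) (c - a)"
    for g :: "real \<Rightarrow> 'a" and a b
  proof (rule curve_length_least)
    fix n and t :: "nat \<Rightarrow> real"
    assume t: "t 0 = a" "t n = b" "mono_on {..n} t"
    have "(\<Sum>i<n. ennreal (dist (g (c - t i)) (g (c - t (Suc i)))))
        = (\<Sum>i<n. ennreal (dist (g (c - t (n - Suc i))) (g (c - t (Suc (n - Suc i))))))"
      by (rule sum.nat_diff_reindex[symmetric])
    also have "\<dots> = (\<Sum>i<n. ennreal (dist (g (c - t (n - i))) (g (c - t (n - Suc i)))))"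
      by (intro sum.cong refl) (simp add: dist_commute Suc_diff_Suc)
    also have "\<dots> \<le> curve_length g (c - b) (c - a)"
      using t by (intro curve_length_upper[of "\<lambda>i. c - t (n - i)"]) (auto simp: mono_on_def)
    finally show "(\<Sum>i<n. ennreal (dist (g (c - t i)) (g (c - t (Suc i))))) \<le> curve_length g (c - b) (c - a)" .
  qed
  show ?thesis
    using le[of g a b] le[of "\<lambda>t. g (c - t)" "c - b" "c - a"] by (simp add: antisym)
qed

text \<open>Juxtaposing a partition of \<open>[a, b]\<close> and a partition of \<open>[b, c]\<close> gives one of \<open>[a, c]\<close>. Both
  intervals must be genuine: for \<open>a > b\<close> there are no partitions and the length is \<open>0\<close>.\<close>
lemma curve_length_superadditive:
  assumes "a \<le> b" "b \<le> c"
  shows "curve_length g a b + curve_length g b c \<le> curve_length g a c"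
proof -
  let ?P = "\<lambda>a b. {(n::nat, t::nat \<Rightarrow> real). t 0 = a \<and> t n = b \<and> mono_on {..n} t}"
  let ?S = "\<lambda>(n::nat, t::nat \<Rightarrow> real). \<Sum>i<n. ennreal (dist (g (t i)) (g (t (Suc i))))"
  have join: "?S (n, t) + ?S (m, r) \<le> curve_length g a c"
    if t: "t 0 = a" "t n = b" "mono_on {..n} t" and r: "r 0 = b" "r m = c" "mono_on {..m} r"
    for n m and t r :: "nat \<Rightarrow> real"
  proof -
    define q where "q i = (if i \<le> n then t i else r (i - n))" for i
    have q_r: "q (n + i) = r i" for i using t r by (auto simp: q_def)
    have "mono_on {..n + m} q"
    proof (rule mono_onI)
      fix i j assume ij: "i \<in> {..n + m}" "j \<in> {..n + m}" "i \<le> j"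
      consider "j \<le> n" | "i \<le> n" "n < j" | "n < i" by linarith
      then show "q i \<le> q j"
      proof cases
        case 1 then show ?thesis using ij mono_onD[OF t(3), of i j] by (auto simp: q_def)
      next
        case 2
        then have "t i \<le> b" "b \<le> r (j - n)"
          using ij partition_in_interval[OF t, of i] partition_in_interval[OF r, of "j - n"] by auto
        then show ?thesis using 2 by (auto simp: q_def)
      next
        case 3 then show ?thesis
          using ij mono_onD[OF r(3), of "i - n" "j - n"] by (auto simp: q_def)
      qed
    qed
    then have "?S (n + m, q) \<le> curve_length g a c"
      using t r q_r[of m] curve_length_upper[of q a "n + m" c g] by (auto simp: q_def)
    moreover have "(\<Sum>i<n + m. F i) = (\<Sum>i<n. F i) + (\<Sum>i<m. F (n + i))" for F :: "nat \<Rightarrow> ennreal"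
      by (induction m) (auto simp: add.assoc)
    moreover have "?S (n, q) = ?S (n, t)"
      unfolding prod.case by (intro sum.cong) (auto simp: q_def)
    ultimately show ?thesis by (simp only: q_r prod.case flip: add_Suc_right)
  qed
  have ne: "?P x y \<noteq> {}" if "x \<le> y" for x y
    using that by (auto simp: mono_on_def intro!: exI[of _ "Suc 0"] exI[of _ "\<lambda>i. if i = 0 then x else y"])
  have "?S (n, t) + curve_length g b c \<le> curve_length g a c"
    if "t 0 = a" "t n = b" "mono_on {..n} t" for n and t :: "nat \<Rightarrow> real"
    unfolding curve_length_def[of g b c] ennreal_SUP_add_right[OF ne[OF assms(2)]]
  proof (rule SUP_least)
    fix p assume "p \<in> ?P b c"
    then show "?S (n, t) + ?S p \<le> curve_length g a c"
      using join[OF that, of "snd p" "fst p"] by (auto simp del: sum_ennreal)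
  qed
  then show ?thesis
    unfolding curve_length_def[of g a b] ennreal_SUP_add_left[OF ne[OF assms(1)], symmetric]
    by (intro SUP_least) auto
qed

text \<open>Truncating the points of a partition of \<open>[a, c]\<close> from above and from below at \<open>b\<close> yields
  partitions of the two halves, with the same number of points. Only the step across \<open>b\<close> is
  affected, and there the triangle inequality applies.\<close>
lemma curve_length_subadditive:
  assumes "a \<le> b" "b \<le> c"
  shows "curve_length g a c \<le> curve_length g a b + curve_length g b c"
proof (rule curve_length_least)
  fix n and t :: "nat \<Rightarrow> real"
  assume t: "t 0 = a" "t n = c" "mono_on {..n} t"
  let ?p = "\<lambda>i. min (t i) b" and ?q = "\<lambda>i. max (t i) b"
  have "(\<Sum>i<n. ennreal (dist (g (t i)) (g (t (Suc i)))))
     \<le> (\<Sum>i<n. ennreal (dist (g (?p i)) (g (?p (Suc i)))) + ennreal (dist (g (?q i)) (g (?q (Suc i)))))"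
  proof (rule sum_mono)
    fix i assume "i \<in> {..<n}"
    then have "t i \<le> t (Suc i)" using mono_onD[OF t(3), of i "Suc i"] by auto
    then have "dist (g (t i)) (g (t (Suc i)))
       \<le> dist (g (?p i)) (g (?p (Suc i))) + dist (g (?q i)) (g (?q (Suc i)))"
      using dist_triangle[of "g (t i)" "g (t (Suc i))" "g b"] by (auto simp: min_def max_def)
    then show "ennreal (dist (g (t i)) (g (t (Suc i))))
       \<le> ennreal (dist (g (?p i)) (g (?p (Suc i)))) + ennreal (dist (g (?q i)) (g (?q (Suc i))))"
      by (simp add: ennreal_leI flip: ennreal_plus)
  qed
  also have "\<dots> = (\<Sum>i<n. ennreal (dist (g (?p i)) (g (?p (Suc i)))))
       + (\<Sum>i<n. ennreal (dist (g (?q i)) (g (?q (Suc i)))))"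
    by (rule sum.distrib)
  also have "\<dots> \<le> curve_length g a b + curve_length g b c"
  proof (intro add_mono curve_length_upper)
    show "mono_on {..n} ?p" "mono_on {..n} ?q"
      by (intro mono_onI min.mono max.mono order_refl mono_onD[OF t(3)]; assumption)+
  qed (use t assms in auto)
  finally show "(\<Sum>i<n. ennreal (dist (g (t i)) (g (t (Suc i))))) \<le> curve_length g a b + curve_length g b c" .
qed

text \<open>To recognize an arc length parametrization it suffices to bound increments from above and to
  bound the total length from below: a piece shorter than its parameter interval could not be
  compensated elsewhere. This form is the one that survives reversal and concatenation.\<close>
lemma arc_length_param_iff:
  "arc_length_param g l \<longleftrightarrow>
     0 \<le> l \<and> (\<forall>s t. 0 \<le> s \<longrightarrow> s \<le> t \<longrightarrow> t \<le> l \<longrightarrow> dist (g s) (g t) \<le> t - s) \<and>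
     ennreal l \<le> curve_length g 0 l"
proof safe
  assume g: "arc_length_param g l"
  then show "0 \<le> l" "ennreal l \<le> curve_length g 0 l"
    by (auto simp: arc_length_param_def)
  fix s t :: real assume st: "0 \<le> s" "s \<le> t" "t \<le> l"
  have "ennreal s + ennreal (dist (g s) (g t)) \<le> curve_length g 0 s + curve_length g s t"
    using g st dist_le_curve_length[of s t g] by (auto simp: arc_length_param_def intro!: add_mono)
  also have "\<dots> \<le> curve_length g 0 t" using st by (intro curve_length_superadditive)
  also have "\<dots> = ennreal t" using g st by (auto simp: arc_length_param_def)
  finally have "ennreal (s + dist (g s) (g t)) \<le> ennreal t" using st by simp
  then show "dist (g s) (g t) \<le> t - s" using st by (subst (asm) ennreal_le_iff) auto
next
  assume l: "0 \<le> l" "ennreal l \<le> curve_length g 0 l"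
    and lip: "\<forall>s t. 0 \<le> s \<longrightarrow> s \<le> t \<longrightarrow> t \<le> l \<longrightarrow> dist (g s) (g t) \<le> t - s"
  have "1-lipschitz_on {0..l} g"
  proof (rule lipschitz_onI)
    fix s t assume "s \<in> {0..l}" "t \<in> {0..l}"
    then show "dist (g s) (g t) \<le> 1 * dist s t"
      using lip by (cases "s \<le> t") (auto simp: dist_real_def dist_commute[of "g s"])
  qed simp
  moreover have "curve_length g 0 t = ennreal t" if t: "t \<in> {0..l}" for t
  proof (rule antisym)
    show "curve_length g 0 t \<le> ennreal t"
      using curve_length_le_of_lipschitz[of 0 t g] lip t by auto
    have "ennreal t + ennreal (l - t) = ennreal l"
      using t by (simp flip: ennreal_plus)
    also have "\<dots> \<le> curve_length g 0 t + curve_length g t l"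
      using t l curve_length_subadditive[of 0 t l g] by (auto intro: order_trans)
    also have "\<dots> \<le> curve_length g 0 t + ennreal (l - t)"
      using curve_length_le_of_lipschitz[of t l g] lip t by (intro add_left_mono) auto
    finally show "ennreal t \<le> curve_length g 0 t"
      by (simp add: ennreal_add_left_cancel_le add.commute)
  qed
  ultimately show "arc_length_param g l"
    using l lipschitz_on_continuous_on by (auto simp: arc_length_param_def)
qed

lemma arc_length_param_reverse:
  "arc_length_param g l \<Longrightarrow> arc_length_param (\<lambda>t. g (l - t)) l"
  unfolding arc_length_param_iff
  by (auto simp: curve_length_reverse dist_commute)
     (smt (verit) dist_commute)


text \<open>Used to locate a parameter of an infinite concatenation within one of the pieces.\<close>
lemma partial_sums_cover:
  fixes l :: "nat \<Rightarrow> real"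
  assumes "summable l" "0 \<le> t" "t < suminf l"
  obtains n where "sum l {..<n} \<le> t" "t \<le> sum l {..<Suc n}"
proof -
  have "\<exists>m. t < sum l {..<m}"
    using order_tendstoD(1)[OF summable_LIMSEQ[OF assms(1)] assms(3)]
    by (auto dest: eventually_happens)
  then have m: "t < sum l {..<(LEAST m. t < sum l {..<m})}" by (rule LeastI_ex)
  then have "(LEAST m. t < sum l {..<m}) \<noteq> 0" using assms(2) by (auto intro: ccontr)
  then obtain n where n: "(LEAST m. t < sum l {..<m}) = Suc n" by (cases "LEAST m. t < sum l {..<m}") auto
  with not_less_Least[of n "\<lambda>m. t < sum l {..<m}"] m show thesis
    by (intro that[of n]) (simp_all add: not_less)
qed

lemma dist_le_diff_partial_sums:
  fixes l :: "nat \<Rightarrow> real"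
  assumes "\<And>n. dist (X n) (X (Suc n)) \<le> l n" "m \<le> n"
  shows "dist (X m) (X n) \<le> sum l {..<n} - sum l {..<m}"
  using assms(2)
proof (induction n rule: dec_induct)
  case (step n)
  then show ?case
    using assms(1)[of n] dist_triangle[of "X m" "X (Suc n)" "X n"] by simp
qed simp

text \<open>Infinitely many curves of finite total length are run through one after the other, and
  the limit of their end points is added as the final point.\<close>
lemma arc_length_param_concat:
  fixes l :: "nat \<Rightarrow> real" and g :: "nat \<Rightarrow> real \<Rightarrow> 'a::metric_space"
  assumes g: "\<And>n. arc_length_param (g n) (l n)"
    and ends: "\<And>n. g n 0 = X n" "\<And>n. g n (l n) = X (Suc n)"
    and l: "summable l" and x: "X \<longlonglongrightarrow> x"
  obtains G where "arc_length_param G (suminf l)" "G 0 = X 0" "G (suminf l) = x"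
    "\<And>n t. sum l {..<n} \<le> t \<Longrightarrow> t \<le> sum l {..<Suc n} \<Longrightarrow> G t = g n (t - sum l {..<n})"
proof -
  define s where "s n = sum l {..<n}" for n
  let ?L = "suminf l"
  have l0: "0 \<le> l n" for n using g[of n] by (simp add: arc_length_param_iff)
  have s_Suc: "s (Suc n) = s n + l n" and s_0: "s 0 = 0" for n by (simp_all add: s_def)
  have s_mono: "s m \<le> s n" if "m \<le> n" for m n
    using that l0 unfolding s_def by (intro sum_mono2) auto
  have s_le: "s n \<le> ?L" for n
    unfolding s_def using l l0 by (intro sum_le_suminf) auto
  have s_lim: "s \<longlonglongrightarrow> ?L" unfolding s_def using l by (rule summable_LIMSEQ)
  have g_lip: "dist (g n a) (g n b) \<le> b - a" if "0 \<le> a" "a \<le> b" "b \<le> l n" for n a b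
    using g[of n] that by (auto simp: arc_length_param_iff)
  have "dist (X n) (X (Suc n)) \<le> l n" for n
    using g_lip[of 0 "l n" n] l0[of n] by (simp add: ends)
  then have X_dist: "dist (X m) (X n) \<le> s n - s m" if "m \<le> n" for m n
    unfolding s_def using that by (rule dist_le_diff_partial_sums)
  have x_dist: "dist (X n) x \<le> ?L - s n" for n
  proof (rule LIMSEQ_le)
    show "(\<lambda>m. dist (X n) (X m)) \<longlonglongrightarrow> dist (X n) x" by (intro tendsto_intros x)
    show "(\<lambda>m. s m - s n) \<longlonglongrightarrow> ?L - s n" by (intro tendsto_intros s_lim)
    show "\<exists>N. \<forall>m\<ge>N. dist (X n) (X m) \<le> s m - s n" using X_dist by auto
  qed
  \<comment> \<open>On \<open>[0, ?L]\<close> the alternative \<open>x\<close> is taken at most at \<open>t = ?L\<close>, namely if no partial sum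
    reaches \<open>?L\<close>.\<close>
  define N where "N t = (LEAST n. t \<le> s (Suc n))" for t
  define G where "G t = (if \<exists>n. t \<le> s (Suc n) then g (N t) (t - s (N t)) else x)" for t
  have piece: "G t = g n (t - s n)" if t: "s n \<le> t" "t \<le> s (Suc n)" for n t
  proof -
    have N: "N t \<le> n" "t \<le> s (Suc (N t))"
      using t(2) unfolding N_def by (auto intro: Least_le LeastI)
    have G: "G t = g (N t) (t - s (N t))" using t(2) by (auto simp: G_def)
    \<comment> \<open>A breakpoint may belong to several pieces if those between have length zero; such pieces do
      not move, so all of them give the same value.\<close>
    show ?thesis
    proof (cases "N t = n")
      case False
      then have eq: "t = s n" "s (Suc (N t)) = s n" and "Suc (N t) \<le> n"
        using N t s_mono[of "Suc (N t)" n] by auto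
      then have "X (Suc (N t)) = X n" using X_dist[of "Suc (N t)" n] by simp
      moreover have "t - s (N t) = l (N t)" using eq s_Suc[of "N t"] by simp
      ultimately show ?thesis using G eq(1) ends by simp
    qed (use G in simp)
  qed
  have G_s: "G (s n) = X n" for n using piece[of n "s n"] ends s_mono[of n "Suc n"] by simp
  \<comment> \<open>If a partial sum reaches \<open>?L\<close>, then the sequence \<open>X\<close> is constant from there on.\<close>
  have G_L: "G ?L = x"
  proof (cases "\<exists>n. ?L \<le> s (Suc n)")
    case True
    then obtain n where "s (Suc n) = ?L" using s_le antisym by blast
    then show ?thesis using x_dist[of "Suc n"] G_s[of "Suc n"] by simp
  qed (simp add: G_def)
  have lip: "dist (G a) (G b) \<le> b - a" if "0 \<le> a" "a \<le> b" "b \<le> s n" for a b n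
    using that
  proof (induction n arbitrary: a b)
    case 0
    then have "a = b" by (simp add: s_0)
    then show ?case by simp
  next
    case (Suc n)
    have last: "dist (G a) (G b) \<le> b - a" if "s n \<le> a" "a \<le> b" "b \<le> s (Suc n)" for a b
      using g_lip[of "a - s n" "b - s n" n] piece[of n a] piece[of n b] that by (simp add: s_Suc)
    consider "b \<le> s n" | "s n \<le> a" | "a \<le> s n" "s n \<le> b" by linarith
    then show ?case
    proof cases
      case 3
      then show ?thesis
        using Suc.IH[of a "s n"] last[of "s n" b] dist_triangle[of "G a" "G b" "G (s n)"] Suc.prems by simp
    qed (use Suc last in auto)
  qed
  have lip_L: "dist (G a) (G b) \<le> b - a" if ab: "0 \<le> a" "a \<le> b" "b \<le> ?L" for a b
  proof -
    have ex: "\<exists>n. c < s n" if "c < ?L" for c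
      using order_tendstoD(1)[OF s_lim that] by (auto dest: eventually_happens)
    consider "b < ?L" | "a < ?L" "b = ?L" | "a = b" using ab by linarith
    then show ?thesis
    proof cases
      case 1
      then obtain n where "b < s n" using ex by blast
      then show ?thesis using lip[of a b n] ab by simp
    next
      case 2
      then obtain n where n: "a < s n" using ex by blast
      have "dist (G a) x \<le> dist (G a) (X n) + dist (X n) x" by (rule dist_triangle)
      also have "\<dots> \<le> (s n - a) + (?L - s n)"
        using lip[of a "s n" n] x_dist[of n] ab n by (intro add_mono) (auto simp: G_s)
      finally show ?thesis using 2 G_L by simp
    qed simp
  qed
  have len: "ennreal (s n) \<le> curve_length G 0 (s n)" for n
  proof (induction n)
    case (Suc n)
    have "curve_length G (s n) (s (Suc n)) = curve_length (\<lambda>t. g n (t + (- s n))) (s n) (s (Suc n))"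
      using piece[of n] by (intro curve_length_cong) auto
    also have "\<dots> = curve_length (g n) 0 (l n)" by (subst curve_length_shift) (simp add: s_Suc)
    also have "\<dots> = ennreal (l n)" using g[of n] l0[of n] by (auto simp: arc_length_param_def)
    finally have "ennreal (s (Suc n)) \<le> curve_length G 0 (s n) + curve_length G (s n) (s (Suc n))"
      using Suc l0[of n] s_mono[of 0 n] by (simp add: s_Suc s_0)
    also have "\<dots> \<le> curve_length G 0 (s (Suc n))"
      using s_mono[of 0 n] s_mono[of n "Suc n"] by (intro curve_length_superadditive) (auto simp: s_0)
    finally show ?case .
  qed (simp add: s_0)
  have "ennreal (s n) \<le> curve_length G 0 ?L" for n
  proof -
    have "curve_length G 0 (s n) + 0 \<le> curve_length G 0 (s n) + curve_length G (s n) ?L"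
      by (intro add_left_mono) simp
    also have "\<dots> \<le> curve_length G 0 ?L"
      using s_mono[of 0 n] s_le[of n] by (intro curve_length_superadditive) (auto simp: s_0)
    finally show ?thesis using len[of n] by (auto intro: order_trans)
  qed
  then have "ennreal ?L \<le> curve_length G 0 ?L"
    using tendsto_ennrealI[OF s_lim] by (intro LIMSEQ_le_const2) auto
  moreover have "0 \<le> ?L" using s_le[of 0] by (simp add: s_0)
  ultimately have "arc_length_param G ?L" using lip_L by (auto simp: arc_length_param_iff)
  then show thesis using that G_L G_s[of 0] piece unfolding s_def by auto
qed

section \<open>The distance \<open>L\<^sub>f\<close>\<close>

lemma line_integrand_measurable:
  fixes f :: "'a::metric_space \<Rightarrow> real" and g :: "real \<Rightarrow> 'a"
  assumes f: "f \<in> borel_measurable (restrict_space borel S)"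
    and g: "continuous_on {0..l} g" "g ` {0..l} \<subseteq> S"
  shows "(\<lambda>t. ennreal (f (g t)) * indicator {0..l} t) \<in> borel_measurable borel"
proof -
  have "g \<in> measurable (restrict_space borel {0..l}) (restrict_space borel S)"
    using g borel_measurable_continuous_on_restrict[OF g(1)]
    by (intro measurable_restrict_space2) (auto simp: space_restrict_space)
  from measurable_compose[OF this f]
  have "(\<lambda>t. ennreal (f (g t))) \<in> borel_measurable (restrict_space borel {0..l})"
    by measurable
  then show ?thesis
    by (subst (asm) borel_measurable_restrict_space_iff_ennreal) (auto intro: borel_closed)
qed

lemma Gamma_f_D:
  assumes "(l, g) \<in> Gamma_f f \<Omega> x y"
  shows "0 \<le> l" "dist x y \<le> l" "x \<in> closure \<Omega>"
proof -
  have g: "arc_length_param g l" "g ` {0..l} \<subseteq> closure \<Omega>" "g 0 = x" "g l = y"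
    using assms by (auto simp: Gamma_f_def)
  then show l: "0 \<le> l" by (simp add: arc_length_param_iff)
  show "dist x y \<le> l" using g l unfolding arc_length_param_iff by force
  have "g 0 \<in> g ` {0..l}" using l by auto
  then show "x \<in> closure \<Omega>" using g by auto
qed

lemma Gamma_f_const: "x \<in> closure \<Omega> \<Longrightarrow> (0, \<lambda>_. x) \<in> Gamma_f f \<Omega> x x"
  and line_integral_zero_length: "line_integral f 0 g = 0"
proof -
  have "AE t in lborel. ennreal (f (g t)) * indicator {0..0} t = 0" for g :: "real \<Rightarrow> 'a"
    using AE_lborel_singleton[of 0] by eventually_elim auto
  then have *: "line_integral f 0 g = 0" for g
    unfolding line_integral_def by (subst nn_integral_cong_AE[where v="\<lambda>_. 0"]) auto
  then show "line_integral f 0 g = 0" .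
  show "x \<in> closure \<Omega> \<Longrightarrow> (0, \<lambda>_. x) \<in> Gamma_f f \<Omega> x x"
    using * by (auto simp: Gamma_f_def arc_length_param_iff)
qed

lemma Gamma_f_reverse:
  assumes f: "f \<in> borel_measurable (restrict_space borel (closure \<Omega>))"
    and g: "(l, g) \<in> Gamma_f f \<Omega> x y"
  shows "(l, \<lambda>t. g (l - t)) \<in> Gamma_f f \<Omega> y x"
    and "line_integral f l (\<lambda>t. g (l - t)) = line_integral f l g"
proof -
  have g': "arc_length_param g l" "g ` {0..l} \<subseteq> closure \<Omega>" "g 0 = x" "g l = y" "line_integral f l g < \<infinity>"
    using g by (auto simp: Gamma_f_def)
  then have "(\<lambda>t. ennreal (f (g t)) * indicator {0..l} t) \<in> borel_measurable borel"
    using line_integrand_measurable[OF f] by (auto simp: arc_length_param_def)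
  from nn_integral_real_affine[OF this, of "-1" l]
  have "line_integral f l g = (\<integral>\<^sup>+ t. ennreal (f (g (l - t))) * indicator {0..l} (l - t) \<partial>lborel)"
    by (simp add: line_integral_def)
  also have "\<dots> = line_integral f l (\<lambda>t. g (l - t))"
    unfolding line_integral_def by (intro nn_integral_cong) (auto simp: indicator_def)
  finally show eq: "line_integral f l (\<lambda>t. g (l - t)) = line_integral f l g" by simp
  show "(l, \<lambda>t. g (l - t)) \<in> Gamma_f f \<Omega> y x"
    using g' arc_length_param_reverse[of g l] eq by (auto simp: Gamma_f_def)
qed

lemma L_f_le: "(l, g) \<in> Gamma_f f \<Omega> x y \<Longrightarrow> L_f f \<Omega> x y \<le> line_integral f l g"
  unfolding L_f_def by (intro INF_lower2[of "(l, g)"]) auto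

lemma L_f_approx:
  assumes "Gamma_f f \<Omega> x y \<noteq> {}" "e > 0"
  obtains l g where "(l, g) \<in> Gamma_f f \<Omega> x y" "line_integral f l g \<le> L_f f \<Omega> x y + ennreal e"
proof -
  obtain l0 g0 where "(l0, g0) \<in> Gamma_f f \<Omega> x y" using assms(1) by auto
  then have "L_f f \<Omega> x y < top" using L_f_le[of l0 g0] by (auto simp: Gamma_f_def intro: le_less_trans)
  then have "L_f f \<Omega> x y < L_f f \<Omega> x y + ennreal e"
    using assms(2) by (metis ennreal_add_left_cancel_less add.right_neutral ennreal_less_zero_iff infinity_ennreal_def less_top)
  then show thesis using that by (subst (asm) L_f_def) (auto simp: INF_less_iff intro: less_imp_le)
qed

lemma L_f_finite: "Gamma_f f \<Omega> x y \<noteq> {} \<Longrightarrow> L_f f \<Omega> x y < top"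
  unfolding L_f_def by (auto simp: INF_less_iff Gamma_f_def)

lemma L_f_commute:
  assumes f: "f \<in> borel_measurable (restrict_space borel (closure \<Omega>))"
  shows "L_f f \<Omega> x y = L_f f \<Omega> y x"
proof -
  have "L_f f \<Omega> x y \<le> L_f f \<Omega> y x" for x y
    unfolding L_f_def[of _ _ y x]
  proof (rule INF_greatest, clarify)
    fix l g assume "(l, g) \<in> Gamma_f f \<Omega> y x"
    then show "L_f f \<Omega> x y \<le> line_integral f l g"
      using L_f_le[OF Gamma_f_reverse(1)[OF f]] Gamma_f_reverse(2)[OF f] by metis
  qed
  then show ?thesis by (simp add: antisym)
qed

lemma L_f_refl: "x \<in> closure \<Omega> \<Longrightarrow> L_f f \<Omega> x x = 0"
  using L_f_le[OF Gamma_f_const, of x \<Omega> f] by (simp add: line_integral_zero_length)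

text \<open>Countable subadditivity along a convergent sequence, by concatenating curves. Choosing
  almost optimal curves, this gives both the triangle inequality and completeness.\<close>
lemma L_f_le_suminf:
  fixes f :: "'a::metric_space \<Rightarrow> real" and l :: "nat \<Rightarrow> real"
  assumes f: "f \<in> borel_measurable (restrict_space borel (closure \<Omega>))"
    and g: "\<And>n. (l n, g n) \<in> Gamma_f f \<Omega> (X n) (X (Suc n))"
    and l: "summable l" and x: "X \<longlonglongrightarrow> x"
  shows "L_f f \<Omega> (X 0) x \<le> (\<Sum>n. line_integral f (l n) (g n))"
proof (cases "(\<Sum>n. line_integral f (l n) (g n)) = \<infinity>")
  case False
  let ?s = "\<lambda>n. sum l {..<n}" and ?L = "suminf l"
  have g': "arc_length_param (g n) (l n)" "g n ` {0..l n} \<subseteq> closure \<Omega>" "g n 0 = X n" "g n (l n) = X (Suc n)" for n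
    using g[of n] by (auto simp: Gamma_f_def)
  obtain G where G: "arc_length_param G ?L" "G 0 = X 0" "G ?L = x"
    and piece: "\<And>n t. ?s n \<le> t \<Longrightarrow> t \<le> ?s (Suc n) \<Longrightarrow> G t = g n (t - ?s n)"
    using arc_length_param_concat[OF g'(1,3,4) l x] by blast
  have X: "X n \<in> closure \<Omega>" for n
    using g Gamma_f_D(3) by metis
  have cover: "\<exists>n. G t = g n (t - ?s n) \<and> t - ?s n \<in> {0..l n}" if "0 \<le> t" "t < ?L" for t
    using partial_sums_cover[OF l that] piece by (metis atLeastAtMost_iff diff_ge_0_iff_ge diff_le_eq add.commute sum.lessThan_Suc)
  have "G ` {0..?L} \<subseteq> closure \<Omega>"
  proof clarify
    fix t assume t: "t \<in> {0..?L}"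
    show "G t \<in> closure \<Omega>"
    proof (cases "t = ?L")
      case True
      then show ?thesis using G(3) x X closed_sequentially[OF closed_closure] by blast
    next
      case False
      then show ?thesis using cover[of t] t g'(2) by force
    qed
  qed
  define F where "F n t = ennreal (f (g n t)) * indicator {0..l n} t" for n t
  have F: "F n \<in> borel_measurable borel" for n
    unfolding F_def using g'(1,2)[of n] line_integrand_measurable[OF f]
    by (auto simp: arc_length_param_def)
  \<comment> \<open>The end point \<open>?L\<close> may lie in no piece, but a single parameter does not contribute.\<close>
  have "line_integral f ?L G \<le> (\<integral>\<^sup>+ t. (\<Sum>n. F n (t - ?s n)) \<partial>lborel)"
    unfolding line_integral_def
  proof (rule nn_integral_mono_AE)
    show "AE t in lborel. ennreal (f (G t)) * indicator {0..?L} t \<le> (\<Sum>n. F n (t - ?s n))"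
      using AE_lborel_singleton[of ?L]
    proof eventually_elim
      case (elim t)
      show ?case
      proof (cases "t \<in> {0..?L}")
        case True
        with elim cover[of t] obtain n where n: "G t = g n (t - ?s n)" "t - ?s n \<in> {0..l n}" by force
        then have "ennreal (f (G t)) * indicator {0..?L} t = (\<Sum>i\<in>{n}. F i (t - ?s i))"
          using True by (simp add: F_def)
        also have "\<dots> \<le> (\<Sum>n. F n (t - ?s n))" by (intro sum_le_suminf) auto
        finally show ?thesis .
      qed simp
    qed
  qed
  also have "\<dots> = (\<Sum>n. \<integral>\<^sup>+ t. F n (t - ?s n) \<partial>lborel)"
    using F by (intro nn_integral_suminf measurable_compose[OF _ F]) measurable
  also have "\<dots> = (\<Sum>n. line_integral f (l n) (g n))"
  proof (rule suminf_cong)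
    fix n
    have "(\<integral>\<^sup>+ t. F n t \<partial>lborel) = (\<integral>\<^sup>+ t. F n (t - ?s n) \<partial>lborel)"
      using nn_integral_real_affine[OF F[of n], of 1 "- ?s n"] by simp
    then show "(\<integral>\<^sup>+ t. F n (t - ?s n) \<partial>lborel) = line_integral f (l n) (g n)"
      by (simp add: F_def line_integral_def)
  qed
  finally have le: "line_integral f ?L G \<le> (\<Sum>n. line_integral f (l n) (g n))" .
  then have "(?L, G) \<in> Gamma_f f \<Omega> (X 0) x"
    using False G \<open>G ` {0..?L} \<subseteq> closure \<Omega>\<close> by (auto simp: Gamma_f_def less_top top_unique)
  then show ?thesis using L_f_le le by (blast intro: order_trans)
qed simp

text \<open>The case of two curves, followed by constant curves of length zero.\<close>
lemma L_f_triangle: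
  fixes f :: "'a::metric_space \<Rightarrow> real"
  assumes f: "f \<in> borel_measurable (restrict_space borel (closure \<Omega>))"
    and z: "z \<in> closure \<Omega>"
  shows "L_f f \<Omega> x z \<le> L_f f \<Omega> x y + L_f f \<Omega> y z"
proof (cases "Gamma_f f \<Omega> x y \<noteq> {} \<and> Gamma_f f \<Omega> y z \<noteq> {}")
  case True
  show ?thesis
  proof (rule ennreal_le_epsilon)
    fix e :: real assume e: "e > 0"
    obtain l1 g1 where 1: "(l1, g1) \<in> Gamma_f f \<Omega> x y" "line_integral f l1 g1 \<le> L_f f \<Omega> x y + ennreal (e/2)"
      using L_f_approx[of f \<Omega> x y "e/2"] True e by auto
    obtain l2 g2 where 2: "(l2, g2) \<in> Gamma_f f \<Omega> y z" "line_integral f l2 g2 \<le> L_f f \<Omega> y z + ennreal (e/2)"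
      using L_f_approx[of f \<Omega> y z "e/2"] True e by auto
    define l where "l n = (if n = 0 then l1 else if n = 1 then l2 else 0)" for n :: nat
    define g where "g n = (if n = 0 then g1 else if n = 1 then g2 else (\<lambda>_. z))" for n :: nat
    define X where "X n = (if n = 0 then x else if n = 1 then y else z)" for n :: nat
    have fin: "h sums (\<Sum>n<2. h n)" if "\<And>n. n \<ge> 2 \<Longrightarrow> h n = 0" for h :: "nat \<Rightarrow> 'b::{comm_monoid_add,t2_space}"
      using that by (intro sums_finite) auto
    have "L_f f \<Omega> (X 0) z \<le> (\<Sum>n. line_integral f (l n) (g n))"
    proof (rule L_f_le_suminf[OF f])
      show "(l n, g n) \<in> Gamma_f f \<Omega> (X n) (X (Suc n))" for n
        using 1 2 Gamma_f_const[OF z] by (auto simp: l_def g_def X_def)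
      show "summable l" using fin[of l] by (auto simp: l_def sums_iff)
      show "X \<longlonglongrightarrow> z"
        by (rule tendsto_eventually) (auto simp: X_def eventually_sequentially intro!: exI[of _ 2])
    qed
    also have "\<dots> = (\<Sum>n<2. line_integral f (l n) (g n))"
      using fin[of "\<lambda>n. line_integral f (l n) (g n)"]
      by (intro sums_unique[symmetric]) (auto simp: l_def line_integral_zero_length)
    also have "\<dots> = line_integral f l1 g1 + line_integral f l2 g2"
      by (simp add: l_def g_def numeral_2_eq_2)
    also have "\<dots> \<le> (L_f f \<Omega> x y + ennreal (e/2)) + (L_f f \<Omega> y z + ennreal (e/2))"
      using 1 2 by (intro add_mono)
    also have "\<dots> = L_f f \<Omega> x y + L_f f \<Omega> y z + (ennreal (e/2) + ennreal (e/2))" by (simp add: ac_simps)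
    also have "ennreal (e/2) + ennreal (e/2) = ennreal e"
      using e by (simp flip: ennreal_plus)
    finally show "L_f f \<Omega> x z \<le> L_f f \<Omega> x y + L_f f \<Omega> y z + ennreal e"
      by (simp add: X_def)
  qed
qed (auto simp: L_f_def)


text \<open>During the first \<open>\<delta>\<close> units of arc length the curve cannot have reached the boundary, so it
  runs in \<open>\<Omega>\<close> and pays at least \<open>\<alpha>\<close> per unit.\<close>
lemma line_integral_ge:
  fixes f :: "'a::metric_space \<Rightarrow> real"
  assumes "open \<Omega>" and \<alpha>: "0 \<le> \<alpha>" "\<And>z. z \<in> \<Omega> \<Longrightarrow> \<alpha> \<le> f z"
    and g: "(l, g) \<in> Gamma_f f \<Omega> x y" and \<delta>: "0 \<le> \<delta>" "\<delta> < infdist x (frontier \<Omega>)"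
  shows "ennreal (\<alpha> * min l \<delta>) \<le> line_integral f l g"
proof -
  have g': "arc_length_param g l" "g ` {0..l} \<subseteq> closure \<Omega>" "g 0 = x"
    using g by (auto simp: Gamma_f_def)
  then have l: "0 \<le> l" by (simp add: arc_length_param_iff)
  have in_\<Omega>: "g t \<in> \<Omega>" if t: "0 \<le> t" "t \<le> l" "t \<le> \<delta>" for t
  proof -
    have "dist x (g t) \<le> t" using g' t by (auto simp: arc_length_param_iff)
    then have "g t \<notin> frontier \<Omega>" using infdist_le[of "g t" "frontier \<Omega>" x] t \<delta> by auto
    moreover have "g t \<in> closure \<Omega>" using g'(2) t by auto
    ultimately show ?thesis using \<open>open \<Omega>\<close> by (simp add: frontier_def interior_open)
  qed
  have "ennreal (\<alpha> * min l \<delta>) = ennreal \<alpha> * emeasure lborel {0..min l \<delta>}"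
    using \<alpha>(1) \<delta>(1) l by (simp add: ennreal_mult)
  also have "\<dots> = (\<integral>\<^sup>+ t. ennreal \<alpha> * indicator {0..min l \<delta>} t \<partial>lborel)"
    by (simp add: nn_integral_cmult_indicator)
  also have "\<dots> \<le> line_integral f l g"
    unfolding line_integral_def
    using in_\<Omega> \<alpha>(2) by (intro nn_integral_mono) (auto simp: indicator_def intro!: ennreal_leI)
  finally show ?thesis .
qed

lemma L_f_pos:
  fixes f :: "'a::metric_space \<Rightarrow> real"
  assumes "open \<Omega>" and \<alpha>: "0 < \<alpha>" "\<And>z. z \<in> \<Omega> \<Longrightarrow> \<alpha> \<le> f z"
    and x: "0 < infdist x (frontier \<Omega>)" and "x \<noteq> y"
  shows "0 < L_f f \<Omega> x y"
proof -
  define \<delta> where "\<delta> = infdist x (frontier \<Omega>) / 2"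
  have \<delta>: "0 < \<delta>" "\<delta> < infdist x (frontier \<Omega>)" using x by (auto simp: \<delta>_def)
  have "ennreal (\<alpha> * min (dist x y) \<delta>) \<le> L_f f \<Omega> x y"
    unfolding L_f_def
  proof (rule INF_greatest, clarify)
    fix l g assume g: "(l, g) \<in> Gamma_f f \<Omega> x y"
    then have "dist x y \<le> l" by (rule Gamma_f_D)
    then have "ennreal (\<alpha> * min (dist x y) \<delta>) \<le> ennreal (\<alpha> * min l \<delta>)"
      using \<alpha>(1) by (intro ennreal_leI mult_left_mono) auto
    also have "\<dots> \<le> line_integral f l g"
      using line_integral_ge[OF \<open>open \<Omega>\<close> _ \<alpha>(2) g] \<alpha>(1) \<delta> by simp
    finally show "ennreal (\<alpha> * min (dist x y) \<delta>) \<le> line_integral f l g" .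
  qed
  moreover have "0 < \<alpha> * min (dist x y) \<delta>" using \<alpha>(1) \<delta>(1) \<open>x \<noteq> y\<close> by simp
  ultimately show ?thesis by (metis ennreal_less_zero_iff less_le_trans)
qed

text \<open>Almost optimal curves between consecutive points eventually cost less than \<open>\<alpha> \<delta>\<close>. By
  \<open>line_integral_ge\<close> their lengths are then at most their costs divided by \<open>\<alpha>\<close>, hence summable;
  so \<open>X\<close> converges in the given metric, and the tails of the infinite concatenation are curves
  to the limit whose costs tend to zero.\<close>
lemma L_f_complete:
  fixes f :: "'a::complete_space \<Rightarrow> real"
  assumes f: "f \<in> borel_measurable (restrict_space borel (closure \<Omega>))"
    and "open \<Omega>" and \<alpha>: "0 < \<alpha>" "\<And>z. z \<in> \<Omega> \<Longrightarrow> \<alpha> \<le> f z"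
    and curves: "\<And>n. Gamma_f f \<Omega> (X n) (X (Suc n)) \<noteq> {}"
    and \<delta>: "0 < \<delta>" "\<And>n. \<delta> < infdist (X n) (frontier \<Omega>)"
    and sum: "summable (\<lambda>n. enn2real (L_f f \<Omega> (X n) (X (Suc n))))"
  obtains x where "x \<in> closure \<Omega>" "(\<lambda>n. L_f f \<Omega> (X n) x) \<longlonglongrightarrow> 0"
proof -
  \<comment> \<open>The error \<open>2\<^sup>-\<^sup>n\<close> allowed for the \<open>n\<close>-th curve is summable.\<close>
  define c where "c n = enn2real (L_f f \<Omega> (X n) (X (Suc n))) + (1/2) ^ n" for n
  have c: "summable c" unfolding c_def by (intro summable_add sum summable_geometric) simp
  have c0: "0 \<le> c n" for n by (simp add: c_def)
  have "\<exists>l g. (l, g) \<in> Gamma_f f \<Omega> (X n) (X (Suc n)) \<and> line_integral f l g \<le> ennreal (c n)" for n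
  proof -
    obtain l g where g: "(l, g) \<in> Gamma_f f \<Omega> (X n) (X (Suc n))"
        "line_integral f l g \<le> L_f f \<Omega> (X n) (X (Suc n)) + ennreal ((1/2) ^ n)"
      using L_f_approx[OF curves[of n], of "(1/2) ^ n"] by auto
    have "L_f f \<Omega> (X n) (X (Suc n)) + ennreal ((1/2) ^ n) = ennreal (c n)"
      using L_f_finite[OF curves[of n]] by (simp add: c_def ennreal_enn2real)
    then show ?thesis using g by metis
  qed
  then obtain l g where g: "\<And>n. (l n, g n) \<in> Gamma_f f \<Omega> (X n) (X (Suc n))"
      and int: "\<And>n. line_integral f (l n) (g n) \<le> ennreal (c n)"
    by metis
  have l0: "0 \<le> l n" and X: "X n \<in> closure \<Omega>" and X_dist: "dist (X n) (X (Suc n)) \<le> l n" for n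
    using Gamma_f_D[OF g[of n]] by auto
  have "\<forall>\<^sub>F n in sequentially. c n < \<alpha> * \<delta>"
    using order_tendstoD(2)[OF summable_LIMSEQ_zero[OF c]] \<alpha>(1) \<delta>(1) by simp
  then have "\<forall>\<^sub>F n in sequentially. norm (l n) \<le> c n / \<alpha>"
  proof eventually_elim
    case (elim n)
    have "ennreal (\<alpha> * min (l n) \<delta>) \<le> ennreal (c n)"
      using line_integral_ge[OF \<open>open \<Omega>\<close> _ \<alpha>(2) g[of n] _ \<delta>(2)[of n]] \<alpha>(1) \<delta>(1) int[of n]
      by (auto intro: order_trans)
    then have le: "\<alpha> * min (l n) \<delta> \<le> c n" using c0 by simp
    then have "\<not> \<delta> \<le> l n" using elim by (auto simp: min_absorb2)
    then show ?case using le \<alpha>(1) l0[of n] by (simp add: field_simps)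
  qed
  then have l: "summable l"
    by (rule summable_comparison_test_ev) (intro summable_divide c)
  have "Cauchy X"
  proof (rule metric_CauchyI)
    fix e :: real assume "e > 0"
    then obtain M where M: "\<And>m n. m \<ge> M \<Longrightarrow> n \<ge> M \<Longrightarrow> dist (sum l {..<m}) (sum l {..<n}) < e"
      using metric_CauchyD[OF LIMSEQ_imp_Cauchy[OF summable_LIMSEQ[OF l]]] by blast
    have "dist (X m) (X n) < e" if "M \<le> m" "m \<le> n" for m n
      using dist_le_diff_partial_sums[of X l m n] X_dist that M[of m n] by (auto simp: dist_real_def)
    then show "\<exists>M. \<forall>m\<ge>M. \<forall>n\<ge>M. dist (X m) (X n) < e"
      by (metis dist_commute nle_le)
  qed
  then obtain x where x: "X \<longlonglongrightarrow> x" using Cauchy_convergent convergent_def by blast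
  have "x \<in> closure \<Omega>"
    using closed_sequentially[OF closed_closure] x X by blast
  moreover have "(\<lambda>n. L_f f \<Omega> (X n) x) \<longlonglongrightarrow> 0"
  proof (rule tendsto_sandwich[OF _ _ tendsto_const])
    have "L_f f \<Omega> (X n) x \<le> ennreal (\<Sum>k. c (k + n))" for n
    proof -
      have "L_f f \<Omega> (X (0 + n)) x \<le> (\<Sum>k. line_integral f (l (k + n)) (g (k + n)))"
        using g l x by (intro L_f_le_suminf[OF f]) (auto simp: summable_iff_shift LIMSEQ_ignore_initial_segment)
      also have "\<dots> \<le> (\<Sum>k. ennreal (c (k + n)))"
        using int by (intro suminf_le) auto
      also have "\<dots> = ennreal (\<Sum>k. c (k + n))"
        using c c0 by (intro suminf_ennreal2) (auto simp: summable_iff_shift)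
      finally show ?thesis by simp
    qed
    then show "\<forall>\<^sub>F n in sequentially. L_f f \<Omega> (X n) x \<le> ennreal (\<Sum>k. c (k + n))" by simp
    show "(\<lambda>n. ennreal (\<Sum>k. c (k + n))) \<longlonglongrightarrow> 0"
      using tendsto_ennrealI[OF suminf_exist_split2[OF c]] by simp
  qed simp
  ultimately show thesis by (rule that)
qed

section \<open>Ekeland's variational principle\<close>

text \<open>The relation \<open>w x + \<epsilon> \<rho>(x, y) \<le> w y\<close> is a preorder by the triangle inequality, and a maximal
  element above \<open>x0\<close> is what is wanted. Starting from \<open>x0\<close>, move up greedily to a point where
  \<open>w\<close> is nearly as large as it can become. The growth of \<open>w\<close> pays for the distances, so these are
  summable. The limit lies above all points of the sequence, and nothing above it has a larger
  value of \<open>w\<close>.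

  Completeness of \<open>\<rho>\<close> and semicontinuity of \<open>w\<close> enter only through the last assumption. It
  concerns sequences starting at \<open>x0\<close> along which \<open>w\<close> increases, so that completeness need
  only hold where \<open>w\<close> is at least \<open>w x0\<close>.\<close>
lemma ekeland_variational_principle:
  fixes w :: "'a \<Rightarrow> real" and \<rho> :: "'a \<Rightarrow> 'a \<Rightarrow> real"
  assumes nonneg: "\<And>x y. 0 \<le> \<rho> x y" and refl: "\<And>x. x \<in> S \<Longrightarrow> \<rho> x x = 0"
    and triangle: "\<And>x y z. \<lbrakk>x \<in> S; y \<in> S; z \<in> S\<rbrakk> \<Longrightarrow> \<rho> x z \<le> \<rho> x y + \<rho> y z"
    and bdd: "\<And>x. x \<in> S \<Longrightarrow> w x \<le> B" and x0: "x0 \<in> S" and \<epsilon>: "0 < \<epsilon>"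
    and complete: "\<And>X. \<lbrakk>\<And>n. X n \<in> S; X 0 = x0; incseq (\<lambda>n. w (X n)); summable (\<lambda>n. \<rho> (X n) (X (Suc n)))\<rbrakk>
      \<Longrightarrow> \<exists>x\<in>S. (\<lambda>n. \<rho> (X n) x) \<longlonglongrightarrow> 0 \<and> (\<forall>n. w (X n) \<le> w x)"
  shows "\<exists>x\<in>S. w x0 \<le> w x \<and> (\<forall>y\<in>S. w y \<le> w x + \<epsilon> * \<rho> x y)"
proof -
  define A where "A x = {y \<in> S. w x + \<epsilon> * \<rho> x y \<le> w y}" for x
  have A_trans: "z \<in> A x" if "x \<in> S" "y \<in> A x" "z \<in> A y" for x y z
  proof -
    have "\<epsilon> * \<rho> x z \<le> \<epsilon> * (\<rho> x y + \<rho> y z)"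
      using triangle[of x y z] that \<epsilon> by (intro mult_left_mono) (auto simp: A_def)
    then show ?thesis using that by (auto simp: A_def algebra_simps)
  qed
  have "\<exists>X. \<forall>n. (X n \<in> S \<and> (n = 0 \<longrightarrow> X n = x0)) \<and>
      (X (Suc n) \<in> A (X n) \<and> (\<forall>z\<in>A (X n). w z \<le> w (X (Suc n)) + (1/2) ^ n))"
  proof (rule dependent_nat_choice)
    fix x and n :: nat assume x: "x \<in> S \<and> (n = 0 \<longrightarrow> x = x0)"
    then have ne: "x \<in> A x" using refl by (simp add: A_def)
    have bddA: "bdd_above (w ` A x)" using bdd by (auto simp: A_def bdd_above_def)
    have "w ` A x \<noteq> {}" using ne by blast
    from less_cSupD[OF this, of "Sup (w ` A x) - (1/2) ^ n"]
    obtain y where y: "y \<in> A x" "Sup (w ` A x) - (1/2) ^ n < w y" by auto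
    have "w z \<le> w y + (1/2) ^ n" if "z \<in> A x" for z
      using cSup_upper[OF imageI[OF that] bddA] y(2) by simp
    then show "\<exists>y. (y \<in> S \<and> (Suc n = 0 \<longrightarrow> y = x0)) \<and> y \<in> A x \<and> (\<forall>z\<in>A x. w z \<le> w y + (1/2) ^ n)"
      using y(1) by (auto simp: A_def)
  qed (use x0 in auto)
  then obtain X where X: "\<And>n. X n \<in> S" "X 0 = x0" "\<And>n. X (Suc n) \<in> A (X n)"
      "\<And>n z. z \<in> A (X n) \<Longrightarrow> w z \<le> w (X (Suc n)) + (1/2) ^ n"
    by blast
  have step: "w (X n) + \<epsilon> * \<rho> (X n) (X (Suc n)) \<le> w (X (Suc n))" for n
    using X(3)[of n] by (simp add: A_def)
  have inc: "incseq (\<lambda>n. w (X n))"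
    by (rule incseq_SucI) (use step nonneg \<epsilon> in \<open>smt (verit) mult_nonneg_nonneg\<close>)
  have "\<epsilon> * (\<Sum>i<n. \<rho> (X i) (X (Suc i))) \<le> w (X n) - w x0" for n
  proof (induction n)
    case (Suc n)
    then show ?case using step[of n] by (simp add: distrib_left)
  qed (simp add: X(2))
  then have "(\<Sum>i<n. \<rho> (X i) (X (Suc i))) \<le> (B - w x0) / \<epsilon>" for n
    using bdd[OF X(1)[of n]] \<epsilon> by (smt (verit) mult.commute pos_le_divide_eq)
  then have "summable (\<lambda>n. \<rho> (X n) (X (Suc n)))"
    using nonneg by (intro summableI_nonneg_bounded) auto
  from complete[OF X(1,2) inc this]
  obtain x where x: "x \<in> S" "(\<lambda>n. \<rho> (X n) x) \<longlonglongrightarrow> 0" "\<And>n. w (X n) \<le> w x" by blast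
  have X_A: "X m \<in> A (X n)" if "n \<le> m" for m n
    using that
  proof (induction m rule: dec_induct)
    case base show ?case using X(1) refl by (simp add: A_def)
  qed (use A_trans X in blast)
  have x_A: "x \<in> A (X n)" for n
  proof -
    have "w (X n) + \<epsilon> * (\<rho> (X n) x - \<rho> (X m) x) \<le> w x" if "n \<le> m" for m
    proof -
      have "\<epsilon> * (\<rho> (X n) x - \<rho> (X m) x) \<le> \<epsilon> * \<rho> (X n) (X m)"
        using triangle[OF X(1) X(1) x(1), of n m] \<epsilon> by (intro mult_left_mono) auto
      then show ?thesis using X_A[OF that] x(3)[of m] by (simp add: A_def)
    qed
    moreover have "(\<lambda>m. w (X n) + \<epsilon> * (\<rho> (X n) x - \<rho> (X m) x)) \<longlonglongrightarrow> w (X n) + \<epsilon> * (\<rho> (X n) x - 0)"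
      by (intro tendsto_intros x(2))
    ultimately have "w (X n) + \<epsilon> * (\<rho> (X n) x - 0) \<le> w x"
      by (intro LIMSEQ_le_const2) auto
    then show ?thesis using x(1) by (simp add: A_def)
  qed
  have "w y \<le> w x + \<epsilon> * \<rho> x y" if y: "y \<in> S" for y
  proof (rule ccontr)
    assume neg: "\<not> w y \<le> w x + \<epsilon> * \<rho> x y"
    then have "y \<in> A x" using y by (simp add: A_def)
    then have le: "w y \<le> w x + (1/2) ^ n" for n :: nat
      using X(4)[OF A_trans[OF X(1) x_A]] x(3)[of "Suc n"] by (smt (verit))
    have "w y \<le> w x + 0"
    proof (rule LIMSEQ_le_const)
      show "(\<lambda>n. w x + (1/2) ^ n) \<longlonglongrightarrow> w x + 0"
        by (intro tendsto_intros LIMSEQ_power_zero) simp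
    qed (use le in auto)
    then show False using neg nonneg[of x y] \<epsilon> by (smt (verit) mult_nonneg_nonneg)
  qed
  then show ?thesis using x(1) x(3)[of 0] X(2) by auto
qed


section \<open>Comparison of Monge solutions\<close>

lemma filterlim_vanishing:
  assumes "\<And>n. X n \<in> A" "((\<lambda>n. h (X n)) \<longlongrightarrow> 0) F"
  shows "filterlim X (vanishing A h) F"
  using assms unfolding vanishing_def
  by (simp add: filterlim_inf filterlim_filtercomap_iff filterlim_principal o_def)

lemma USC_L_sequence:
  assumes "u \<in> USC_L f \<Omega>" "x \<in> closure \<Omega>" "\<And>n. X n \<in> closure \<Omega>"
    and "(\<lambda>n. L_f f \<Omega> x (X n)) \<longlonglongrightarrow> 0" and "e > 0"
  shows "\<forall>\<^sub>F n in sequentially. u (X n) < u x + e"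
proof -
  have "\<forall>\<^sub>F y in vanishing (closure \<Omega>) (L_f f \<Omega> x). ereal (u y) < ereal (u x + e)"
    using assms(1,2,5) unfolding USC_L_def Limsup_le_iff mem_Collect_eq
    by (metis less_add_same_cancel1 less_ereal.simps(1))
  from eventually_compose_filterlim[OF this filterlim_vanishing[of X "closure \<Omega>" "L_f f \<Omega> x"]]
  show ?thesis using assms(3,4) by simp
qed

lemma LSC_L_sequence:
  assumes "v \<in> LSC_L f \<Omega>" "x \<in> closure \<Omega>" "\<And>n. X n \<in> closure \<Omega>"
    and "(\<lambda>n. L_f f \<Omega> x (X n)) \<longlonglongrightarrow> 0" and "e > 0"
  shows "\<forall>\<^sub>F n in sequentially. v x - e < v (X n)"
proof -
  have "\<forall>\<^sub>F y in vanishing (closure \<Omega>) (L_f f \<Omega> x). ereal (v x - e) < ereal (v y)"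
    using assms(1,2,5) unfolding LSC_L_def le_Liminf_iff mem_Collect_eq
    by (metis diff_less_eq less_add_same_cancel1 less_ereal.simps(1))
  from eventually_compose_filterlim[OF this filterlim_vanishing[of X "closure \<Omega>" "L_f f \<Omega> x"]]
  show ?thesis using assms(3,4) by simp
qed

text \<open>Dividing the last assumption by \<open>L\<^sub>f(x, y)\<close>, the quotients for \<open>v\<close> are bounded by \<open>\<theta>\<close> times
  those for \<open>u\<close> plus \<open>\<epsilon>\<close>, hence in the limit by \<open>\<theta> + \<epsilon>\<close>.\<close>
lemma monge_slope_less_one:
  fixes f u v :: "'a::metric_space \<Rightarrow> real"
  assumes L: "\<And>y. y \<in> \<Omega> - {x} \<Longrightarrow> 0 < L_f f \<Omega> x y \<and> L_f f \<Omega> x y < top"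
    and u: "monge_slope f \<Omega> u x \<le> 1" and lam: "0 < \<theta>" "\<theta> + \<epsilon> < 1"
    and vu: "\<And>y. y \<in> \<Omega> \<Longrightarrow> v x - v y \<le> \<theta> * (u x - u y) + \<epsilon> * enn2real (L_f f \<Omega> x y)"
  shows "monge_slope f \<Omega> v x < 1"
proof -
  \<comment> \<open>Then \<open>\<theta> \<eta>\<close> is half of the slack \<open>1 - \<theta> - \<epsilon>\<close>, so that the bound below stays under \<open>1\<close>.\<close>
  define \<eta> where "\<eta> = (1 - \<theta> - \<epsilon>) / (2 * \<theta>)"
  have \<eta>: "0 < \<eta>" using lam by (simp add: \<eta>_def)
  have "\<theta> * \<eta> = (1 - \<theta> - \<epsilon>) / 2" using lam(1) by (simp add: \<eta>_def)
  then have q: "\<theta> * (1 + \<eta>) + \<epsilon> < 1" using lam(2) by (simp add: distrib_left)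
  have quot: "ereal a / enn2ereal (L_f f \<Omega> x y) = ereal (a / enn2real (L_f f \<Omega> x y))"
      and pos: "0 < enn2real (L_f f \<Omega> x y)" if "y \<in> \<Omega> - {x}" for a y
  proof -
    show pos: "0 < enn2real (L_f f \<Omega> x y)" using L[OF that] by (simp add: enn2real_positive_iff)
    have "enn2ereal (L_f f \<Omega> x y) = ereal (enn2real (L_f f \<Omega> x y))"
      using L[OF that] by (metis ennreal_enn2real enn2ereal_ennreal enn2real_nonneg)
    then show "ereal a / enn2ereal (L_f f \<Omega> x y) = ereal (a / enn2real (L_f f \<Omega> x y))"
      using pos by simp
  qed
  let ?F = "vanishing (\<Omega> - {x}) (\<lambda>y. L_f f \<Omega> y x)"
  have dom: "\<forall>\<^sub>F y in ?F. y \<in> \<Omega> - {x}"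
    by (simp add: vanishing_def eventually_inf_principal)
  have "1 < ereal (1 + \<eta>)" using \<eta> by (simp add: one_ereal_def)
  then have "\<forall>\<^sub>F y in ?F. ereal (u x - u y) / enn2ereal (L_f f \<Omega> x y) < ereal (1 + \<eta>)"
    using u unfolding monge_slope_def Limsup_le_iff by blast
  with dom have "\<forall>\<^sub>F y in ?F. ereal (v x - v y) / enn2ereal (L_f f \<Omega> x y) \<le> ereal (\<theta> * (1 + \<eta>) + \<epsilon>)"
  proof eventually_elim
    case (elim y)
    let ?r = "enn2real (L_f f \<Omega> x y)"
    note r = pos[OF elim(1)]
    have "u x - u y < (1 + \<eta>) * ?r"
      using elim(2) r by (simp add: quot[OF elim(1)] pos_divide_less_eq)
    then have "\<theta> * (u x - u y) \<le> \<theta> * ((1 + \<eta>) * ?r)"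
      using lam(1) by (intro mult_left_mono) auto
    moreover have "v x - v y \<le> \<theta> * (u x - u y) + \<epsilon> * ?r" using vu elim(1) by blast
    ultimately have "v x - v y \<le> (\<theta> * (1 + \<eta>) + \<epsilon>) * ?r" by (simp add: algebra_simps)
    then show ?case using r by (simp add: quot[OF elim(1)] pos_divide_le_eq)
  qed
  then have "monge_slope f \<Omega> v x \<le> ereal (\<theta> * (1 + \<eta>) + \<epsilon>)"
    unfolding monge_slope_def by (rule Limsup_bounded)
  also have "\<dots> < 1" using q by (simp add: one_ereal_def)
  finally show ?thesis .
qed

theorem theorem3p4:
  fixes \<Omega> :: "'a::complete_space set" and f u v :: "'a \<Rightarrow> real"
  assumes "length_space (UNIV :: 'a set)"
    and "domain \<Omega>" and "bounded \<Omega>" and "\<Omega> \<subset> UNIV"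
    and "f \<in> borel_measurable (restrict_space borel (closure \<Omega>))"
    and "\<forall>x\<in>closure \<Omega>. 0 < f x"
    and "0 < (INF x\<in>\<Omega>. f x)"
    and "\<forall>x\<in>closure \<Omega>. \<forall>y\<in>closure \<Omega>. Gamma_f f \<Omega> x y \<noteq> {}"
    and "u \<in> USC_L f \<Omega>" and "bounded (u ` closure \<Omega>)" and "monge_subsolution f \<Omega> u"
    and "v \<in> LSC_L f \<Omega>" and "bounded (v ` closure \<Omega>)" and "monge_supersolution f \<Omega> v"
    and "\<exists>m::ereal. m \<le> 0 \<and>
           ((\<lambda>\<delta>. SUP x \<in> {x\<in>closure \<Omega>. infdist x (frontier \<Omega>) \<le> \<delta>}. ereal (u x - v x))
              \<longlongrightarrow> m) (at_right 0)"
  shows "\<forall>x\<in>closure \<Omega>. u x \<le> v x"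
proof (rule ccontr)
  let ?S = "closure \<Omega>"
  note f = assms(5)
  assume "\<not> ?thesis"
  then obtain x0 where x0: "x0 \<in> ?S" "v x0 < u x0" by force
  define \<kappa> where "\<kappa> = u x0 - v x0"
  have \<kappa>: "0 < \<kappa>" using x0 by (simp add: \<kappa>_def)
  have "open \<Omega>" using assms(2) by (simp add: domain_def)
  define \<alpha> where "\<alpha> = (INF x\<in>\<Omega>. f x)"
  have "\<Omega> \<subseteq> ?S" by (rule closure_subset)
  then have "bdd_below (f ` \<Omega>)"
    using assms(6) by (intro bdd_belowI2[of _ 0]) (auto intro: less_imp_le)
  then have \<alpha>: "0 < \<alpha>" "\<And>z. z \<in> \<Omega> \<Longrightarrow> \<alpha> \<le> f z"
    using assms(7) by (auto simp: \<alpha>_def intro: cINF_lower)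
  obtain Bu where Bu: "0 < Bu" "\<And>x. x \<in> ?S \<Longrightarrow> \<bar>u x\<bar> \<le> Bu"
    using assms(10) by (auto simp: bounded_pos)
  obtain Bv where Bv: "\<And>x. x \<in> ?S \<Longrightarrow> \<bar>v x\<bar> \<le> Bv"
    using assms(13) by (auto simp: bounded_pos)

  obtain m where m: "m \<le> (0::ereal)"
    "((\<lambda>\<delta>. SUP x \<in> {x\<in>?S. infdist x (frontier \<Omega>) \<le> \<delta>}. ereal (u x - v x)) \<longlongrightarrow> m) (at_right 0)"
    using assms(15) by blast
  have "m < ereal (\<kappa> / 3)" using m(1) \<kappa> by (auto intro: le_less_trans)
  from order_tendstoD(2)[OF m(2) this]
  obtain b where b: "0 < b" "\<And>\<delta>. \<lbrakk>0 < \<delta>; \<delta> < b\<rbrakk> \<Longrightarrow>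
      (SUP x \<in> {x\<in>?S. infdist x (frontier \<Omega>) \<le> \<delta>}. ereal (u x - v x)) < ereal (\<kappa> / 3)"
    by (auto simp: eventually_at_right_field)
  define \<delta> where "\<delta> = b / 2"
  have \<delta>: "0 < \<delta>" "(SUP x \<in> {x\<in>?S. infdist x (frontier \<Omega>) \<le> \<delta>}. ereal (u x - v x)) < ereal (\<kappa> / 3)"
    using b(1) b(2)[of \<delta>] by (auto simp: \<delta>_def)
  \<comment> \<open>For an empty frontier \<open>infdist\<close> is constantly \<open>0\<close>, and this bound holds on all of \<open>?S\<close>.\<close>
  have near: "u x - v x < \<kappa> / 3" if "x \<in> ?S" "infdist x (frontier \<Omega>) \<le> \<delta>" for x
  proof -
    have "ereal (u x - v x) \<le> (SUP x \<in> {x\<in>?S. infdist x (frontier \<Omega>) \<le> \<delta>}. ereal (u x - v x))"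
      using that by (intro SUP_upper) auto
    from le_less_trans[OF this \<delta>(2)] show ?thesis by simp
  qed

  \<comment> \<open>\<open>\<theta>\<close> is so close to \<open>1\<close> that passing from \<open>u - v\<close> to \<open>w\<close> costs at most \<open>\<kappa> / 6\<close>: then \<open>w\<close> is
    below \<open>\<kappa> / 2\<close> near the boundary, but above it at \<open>x0\<close>.\<close>
  define \<theta> where "\<theta> = 1 - min (1/2) (\<kappa> / (6 * Bu))"
  have \<theta>: "1/2 \<le> \<theta>" "\<theta> < 1" "(1 - \<theta>) * Bu \<le> \<kappa> / 6"
    using \<kappa> Bu(1) by (auto simp: \<theta>_def field_simps min_def)
  define \<epsilon> where "\<epsilon> = (1 - \<theta>) / 2"
  have \<epsilon>: "0 < \<epsilon>" "\<theta> + \<epsilon> < 1" using \<theta> by (simp_all add: \<epsilon>_def field_simps)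
  define w where "w x = \<theta> * u x - v x" for x
  have w_near: "\<bar>w x - (u x - v x)\<bar> \<le> \<kappa> / 6" if "x \<in> ?S" for x
  proof -
    have "w x - (u x - v x) = - ((1 - \<theta>) * u x)" by (simp add: w_def algebra_simps)
    then have "\<bar>w x - (u x - v x)\<bar> = (1 - \<theta>) * \<bar>u x\<bar>"
      using \<theta>(2) by (simp add: abs_mult)
    also have "\<dots> \<le> (1 - \<theta>) * Bu" using \<theta>(2) Bu(2)[OF that] by (intro mult_left_mono) auto
    finally show ?thesis using \<theta>(3) by simp
  qed
  have w_x0: "\<kappa> / 2 < w x0"
    using abs_le_D2[OF w_near[OF x0(1)]] \<kappa> unfolding \<kappa>_def[symmetric] by simp
  have far: "\<delta> < infdist x (frontier \<Omega>)" if "x \<in> ?S" "w x0 \<le> w x" for x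
  proof (rule ccontr)
    assume "\<not> ?thesis"
    then have "u x - v x < \<kappa> / 3" using near that(1) by simp
    then show False
      using abs_le_D1[OF w_near[OF that(1)]] w_x0 that(2) by simp
  qed
  define \<rho> where "\<rho> x y = enn2real (L_f f \<Omega> x y)" for x y
  have fin: "L_f f \<Omega> x y < top" if "x \<in> ?S" "y \<in> ?S" for x y
    using assms(8) that by (intro L_f_finite) simp
  have complete: "\<exists>x\<in>?S. (\<lambda>n. \<rho> (X n) x) \<longlonglongrightarrow> 0 \<and> (\<forall>n. w (X n) \<le> w x)"
    if X: "\<And>n. X n \<in> ?S" "X 0 = x0" and inc: "incseq (\<lambda>n. w (X n))"
      and sum: "summable (\<lambda>n. \<rho> (X n) (X (Suc n)))" for X
  proof -
    have "w x0 \<le> w (X n)" for n using incseqD[OF inc, of 0 n] X(2) by simp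
    then have X_far: "\<delta> < infdist (X n) (frontier \<Omega>)" for n using far X(1) by blast
    have curves: "Gamma_f f \<Omega> (X n) (X (Suc n)) \<noteq> {}" for n
      using assms(8) X(1) by simp
    obtain x where x: "x \<in> ?S" and lim: "(\<lambda>n. L_f f \<Omega> (X n) x) \<longlonglongrightarrow> 0"
      using L_f_complete[OF f \<open>open \<Omega>\<close> \<alpha> curves \<delta>(1) X_far sum[unfolded \<rho>_def]] by blast
    have "(\<lambda>n. \<rho> (X n) x) \<longlonglongrightarrow> 0"
      using tendsto_enn2real[of "\<lambda>n. L_f f \<Omega> (X n) x" 0] lim by (simp add: \<rho>_def)
    moreover have "w (X n) \<le> w x" for n
    proof (rule field_le_epsilon)
      fix e :: real assume "e > 0"
      then have e2: "e/2 > 0" by simp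
      have lim': "(\<lambda>n. L_f f \<Omega> x (X n)) \<longlonglongrightarrow> 0" using lim by (simp add: L_f_commute[OF f])
      have "\<forall>\<^sub>F k in sequentially. w (X n) \<le> w x + e"
        using USC_L_sequence[OF assms(9) x X(1) lim' e2]
          LSC_L_sequence[OF assms(12) x X(1) lim' e2] eventually_ge_at_top[of n]
      proof eventually_elim
        case (elim k)
        have "\<theta> * u (X k) \<le> \<theta> * (u x + e/2)" using elim \<theta>(1) by (intro mult_left_mono) auto
        moreover have "\<theta> * e \<le> e" using \<theta>(2) \<open>e > 0\<close> by simp
        ultimately have "w (X k) \<le> w x + e" using elim by (simp add: w_def algebra_simps)
        then show ?case using incseqD[OF inc elim(3)] by simp
      qed
      then show "w (X n) \<le> w x + e" by simp
    qed
    ultimately show ?thesis using x by blast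
  qed
  have \<rho>_nonneg: "0 \<le> \<rho> x y" for x y by (simp add: \<rho>_def)
  have \<rho>_refl: "\<rho> x x = 0" if "x \<in> ?S" for x by (simp add: \<rho>_def L_f_refl[OF that])
  have \<rho>_triangle: "\<rho> x z \<le> \<rho> x y + \<rho> y z" if "x \<in> ?S" "y \<in> ?S" "z \<in> ?S" for x y z
  proof -
    have "\<rho> x z \<le> enn2real (L_f f \<Omega> x y + L_f f \<Omega> y z)"
      unfolding \<rho>_def using L_f_triangle[OF f that(3)] fin that by (intro enn2real_mono) auto
    also have "\<dots> = \<rho> x y + \<rho> y z"
      unfolding \<rho>_def using fin that by (intro enn2real_plus) auto
    finally show ?thesis .
  qed
  have w_bdd: "w x \<le> Bu + Bv" if "x \<in> ?S" for x
  proof -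
    have "\<theta> * u x \<le> \<theta> * Bu" using Bu(2)[OF that] \<theta>(1) by (intro mult_left_mono) auto
    also have "\<dots> \<le> Bu" using \<theta>(2) Bu(1) by simp
    finally show ?thesis using Bv[OF that] by (simp add: w_def)
  qed
  obtain x where x: "x \<in> ?S" "w x0 \<le> w x" "\<And>y. y \<in> ?S \<Longrightarrow> w y \<le> w x + \<epsilon> * \<rho> x y"
    using ekeland_variational_principle[OF \<rho>_nonneg \<rho>_refl \<rho>_triangle w_bdd x0(1) \<epsilon>(1) complete]
    by blast
  have x_far: "\<delta> < infdist x (frontier \<Omega>)" using far x by blast
  then have "x \<notin> frontier \<Omega>" using \<delta>(1) by auto
  then have x_\<Omega>: "x \<in> \<Omega>" using x(1) \<open>open \<Omega>\<close> by (simp add: frontier_def interior_open)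
  have "monge_slope f \<Omega> v x < 1"
  proof (rule monge_slope_less_one[where u = u and \<theta> = \<theta> and \<epsilon> = \<epsilon>])
    show "0 < L_f f \<Omega> x y \<and> L_f f \<Omega> x y < top" if "y \<in> \<Omega> - {x}" for y
      using L_f_pos[OF \<open>open \<Omega>\<close> \<alpha>] x_far \<delta>(1) fin[OF x(1)] that \<open>\<Omega> \<subseteq> ?S\<close> by auto
    show "monge_slope f \<Omega> u x \<le> 1" using assms(11) x_\<Omega> by (simp add: monge_subsolution_def)
    show "v x - v y \<le> \<theta> * (u x - u y) + \<epsilon> * enn2real (L_f f \<Omega> x y)" if "y \<in> \<Omega>" for y
      using x(3)[of y] that \<open>\<Omega> \<subseteq> ?S\<close> by (auto simp: w_def \<rho>_def algebra_simps)
  qed (use \<theta> \<epsilon> in auto)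
  moreover have "1 \<le> monge_slope f \<Omega> v x" using assms(14) x_\<Omega> by (simp add: monge_supersolution_def)
  ultimately show False by simp
qed

end
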